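(* For every small $\epsilon > 0$ there is a constant $C_\epsilon > 0$ such that for every integer $N \geq 2$ the following holds: the set of real numbers $\alpha \in [0,1)$ for which the statement below fails has Lebesgue measure at most $C_\epsilon / \sqrt{\log N}$. Statement for $\alpha$: whenever $a, q$ are integers with $1 \leq q \leq N^2$, $(a,q)=1$ and $|\alpha - \frac{a}{q}| \leq \frac{1}{q N^2}$, there exist integers $a_1, a_2$ and $1 \leq q_1, q_2 \leq N$ such that $$\Big|\alpha - \frac{a_1}{q_1} - \frac{a_2}{q_2}\Big| \leq \frac{C_\epsilon}{q N^{2-\epsilon}}.$$ *)

theory Defs
  imports "HOL-Analysis.Analysis"
begin

definition two_fraction_approx :: "real \<Rightarrow> real \<Rightarrow> int \<Rightarrow> real \<Rightarrow> bool" where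
  "two_fraction_approx C \<epsilon> N \<alpha> \<longleftrightarrow>
     (\<forall>a q :: int. 1 \<le> q \<and> q \<le> N\<^sup>2 \<and> coprime a q \<and>
        \<bar>\<alpha> - of_int a / of_int q\<bar> \<le> 1 / (of_int q * (of_int N)\<^sup>2) \<longrightarrow>
        (\<exists>a\<^sub>1 a\<^sub>2 q\<^sub>1 q\<^sub>2 :: int. 1 \<le> q\<^sub>1 \<and> q\<^sub>1 \<le> N \<and> 1 \<le> q\<^sub>2 \<and> q\<^sub>2 \<le> N \<and>
           \<bar>\<alpha> - of_int a\<^sub>1 / of_int q\<^sub>1 - of_int a\<^sub>2 / of_int q\<^sub>2\<bar>
             \<le> C / (of_int q * of_int N powr (2 - \<epsilon>))))"

end

(*
A sum a1/q1 + a2/q2 with q1, q2 coprime is an arbitrary fraction b/(q1 q2), so it suffices that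
almost every alpha lies within delta = N^(eps - 4) of some b/m with m in the set M of products of
two coprime numbers up to N; since q <= N^2, the approximation a/q plays no further role.
Let f count the intervals of radius delta around the fractions b/m, 0 <= b < m, m in M, that contain
alpha, and let mu = 2 delta (sum of M) be its integral. For each h, the equation h = (a k - b m)/gcd(m,k)
has at most gcd(m,k) solutions a < m, b < k, so the intervals belonging to m and k overlap in measure
at most (2 delta m)(2 delta k) + 2 delta gcd(m,k). Summing, the second moment of f exceeds mu^2 by
at most 2 delta * sum of gcd(m,k) over m, k <= N^2, which is O(delta N^4 log N).
Chebyshev's inequality then bounds the measure of {f = 0}, once M is known to have at least
N^2/(log N)^O(1) elements; this follows by Cauchy-Schwarz because m = q1 q2 has at most d(q1) d(q2)
representations, where d counts divisors. The bound obtained is even a power saving in N.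
*)
theory Submission
  imports Defs "HOL-Real_Asymp.Real_Asymp"
begin

subsection \<open>Divisor sums\<close>

definition divisor_count :: "nat \<Rightarrow> nat" where
  "divisor_count n = card {d. d dvd n}"

lemma card_multiples_le: "card {q \<in> {1..n}. d dvd q} \<le> n div (d::nat)"
proof -
  have "{q \<in> {1..n}. d dvd q} \<subseteq> (*) d ` {1..n div d}"
  proof
    fix q assume "q \<in> {q \<in> {1..n}. d dvd q}"
    then obtain k where k: "q = d * k" "1 \<le> q" "q \<le> n" by auto
    then have "d > 0" "k > 0" by (auto intro: Nat.gr0I)
    with k have "k \<in> {1..n div d}"
      by (simp add: less_eq_div_iff_mult_less_eq mult.commute)
    with k show "q \<in> (*) d ` {1..n div d}" by blast
  qed
  then have "card {q \<in> {1..n}. d dvd q} \<le> card ((*) d ` {1..n div d})"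
    by (intro card_mono) auto
  also have "\<dots> \<le> n div d"
    using card_image_le[of "{1..n div d}" "(*) d"] by simp
  finally show ?thesis .
qed

lemma card_multiples_le_real: "real (card {q \<in> {1..n}. d dvd q}) \<le> real n / real d"
proof -
  have "real (card {q \<in> {1..n}. d dvd q}) \<le> real (n div d)"
    by (intro of_nat_mono card_multiples_le)
  also have "\<dots> \<le> real n / real d"
    by (rule of_nat_div_le_of_nat)
  finally show ?thesis .
qed

text \<open>Double counting: after swapping the sums, each d \<le> n is counted once for each of its
  multiples up to n, and there are at most n/d of these.\<close>

lemma sum_divisor_count_le: "(\<Sum>q=1..n. real (divisor_count q)) \<le> real n * harm n"
proof -
  have "divisor_count q = (\<Sum>d=1..n. if d dvd q then 1 else 0)" if "q \<in> {1..n}" for q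
  proof -
    have "{d. d dvd q} = {d \<in> {1..n}. d dvd q}"
      using that by (auto dest: dvd_imp_le intro: Nat.gr0I simp: Suc_le_eq)
    then show ?thesis
      unfolding divisor_count_def by (simp only: card_eq_sum sum.inter_filter[symmetric] finite_atLeastAtMost)
  qed
  then have "(\<Sum>q=1..n. real (divisor_count q)) = real (\<Sum>q=1..n. \<Sum>d=1..n. if d dvd q then 1 else 0)"
    by simp
  also have "\<dots> = real (\<Sum>d=1..n. \<Sum>q=1..n. if d dvd q then 1 else 0)"
    by (subst sum.swap) simp
  also have "\<dots> = (\<Sum>d=1..n. real (card {q \<in> {1..n}. d dvd q}))"
    by (simp only: card_eq_sum sum.inter_filter[symmetric] finite_atLeastAtMost of_nat_sum)
  also have "\<dots> \<le> (\<Sum>d=1..n. real n / real d)"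
    by (intro sum_mono card_multiples_le_real)
  also have "\<dots> = real n * harm n"
    by (simp add: harm_def sum_distrib_left divide_inverse)
  finally show ?thesis .
qed

text \<open>Every divisor of \<open>a * b\<close> factors as a divisor of \<open>a\<close> times a
  divisor of \<open>b\<close>, so multiplication maps the pairs of divisors onto a superset of the
  divisors of the product.\<close>

lemma divisor_count_mult_le:
  assumes "a > 0" "b > 0"
  shows "divisor_count (a * b) \<le> divisor_count a * divisor_count b"
proof -
  have "{d. d dvd a * b} \<subseteq> (\<lambda>(x, y). x * y) ` ({d. d dvd a} \<times> {d. d dvd b})"
    using division_decomp[of _ a b] by (auto simp: image_iff)
  then have "divisor_count (a * b) \<le> card ((\<lambda>(x, y). x * y) ` ({d. d dvd a} \<times> {d. d dvd b}))"
    unfolding divisor_count_def using assms by (intro card_mono) auto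
  also have "\<dots> \<le> card ({d. d dvd a} \<times> {d. d dvd b})"
    using assms by (intro card_image_le) auto
  finally show ?thesis
    by (simp add: divisor_count_def card_cartesian_product)
qed

text \<open>The gcd is itself one of the common divisors, hence at most their sum. Summed over k, a
  divisor d of m contributes d for each of at most X/d multiples, that is, at most X.\<close>

lemma sum_gcd_le:
  assumes "m > 0"
  shows "(\<Sum>k=1..X. real (gcd m k)) \<le> real X * real (divisor_count m)"
proof -
  have "(\<Sum>k=1..X. real (gcd m k)) \<le> (\<Sum>k=1..X. \<Sum>d\<in>{d. d dvd m}. if d dvd k then real d else 0)"
  proof (rule sum_mono)
    fix k
    have "(\<Sum>d\<in>{gcd m k}. if d dvd k then real d else 0) \<le> (\<Sum>d\<in>{d. d dvd m}. if d dvd k then real d else 0)"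
      using assms by (intro sum_mono2) auto
    then show "real (gcd m k) \<le> (\<Sum>d\<in>{d. d dvd m}. if d dvd k then real d else 0)"
      by simp
  qed
  also have "\<dots> = (\<Sum>d\<in>{d. d dvd m}. \<Sum>k=1..X. if d dvd k then real d else 0)"
    by (rule sum.swap)
  also have "\<dots> = (\<Sum>d\<in>{d. d dvd m}. real d * real (card {k \<in> {1..X}. d dvd k}))"
    by (simp add: sum.inter_filter[symmetric] mult.commute)
  also have "\<dots> \<le> (\<Sum>d\<in>{d. d dvd m}. real X)"
  proof (rule sum_mono)
    fix d assume "d \<in> {d. d dvd m}"
    then have "d > 0" using assms by (auto intro: Nat.gr0I)
    then show "real d * real (card {k \<in> {1..X}. d dvd k}) \<le> real X"
      using card_multiples_le_real[of X d] by (simp add: field_simps)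
  qed
  finally show ?thesis by (simp add: divisor_count_def mult.commute)
qed

lemma sum_sum_gcd_le: "(\<Sum>m=1..X. \<Sum>k=1..X. real (gcd m k)) \<le> (real X)\<^sup>2 * harm X"
proof -
  have "(\<Sum>m=1..X. \<Sum>k=1..X. real (gcd m k)) \<le> (\<Sum>m=1..X. real X * real (divisor_count m))"
    by (intro sum_mono sum_gcd_le) simp
  also have "\<dots> \<le> real X * (real X * harm X)"
    unfolding sum_distrib_left[symmetric] by (intro mult_left_mono sum_divisor_count_le) simp
  finally show ?thesis by (simp add: power2_eq_square mult.assoc)
qed

text \<open>The sequence \<open>harm (Suc i) - ln (Suc i)\<close> decreases and has the value 1 at i
  = 0; the index n - 1 corresponds to \<open>harm n\<close>.\<close>

lemma harm_le_ln: "n > 0 \<Longrightarrow> harm n \<le> 1 + ln (real n)"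
  using decseqD[OF decseq_harm_diff_ln, of 0 "n - 1"] by (simp add: harm_expand)

subsection \<open>Products of two coprime numbers\<close>

definition coprime_pairs :: "nat \<Rightarrow> (nat \<times> nat) set" where
  "coprime_pairs n = {(a, b) \<in> {1..n} \<times> {1..n}. coprime a b}"

definition coprime_products :: "nat \<Rightarrow> nat set" where
  "coprime_products n = (\<lambda>(a, b). a * b) ` coprime_pairs n"

lemma finite_coprime_pairs [simp]: "finite (coprime_pairs n)"
  unfolding coprime_pairs_def by (rule finite_subset[of _ "{1..n} \<times> {1..n}"]) auto

lemma finite_coprime_products [simp]: "finite (coprime_products n)"
  unfolding coprime_products_def by simp

lemma coprime_products_subset: "coprime_products n \<subseteq> {1..n\<^sup>2}"
  by (auto simp: coprime_products_def coprime_pairs_def power2_eq_square intro!: mult_le_mono)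

section \<open>Coprime pairs have positive density\<close>

text \<open>The term 1/n makes the induction telescope, with equality at n = 2. What matters later
  is that 3/4 is less than 1.\<close>

lemma sum_inverse_squares_le:
  "n \<ge> 2 \<Longrightarrow> (\<Sum>d=2..n. 1 / (real d)\<^sup>2) \<le> 3/4 - 1 / real n"
proof (induction n rule: nat_induct_at_least)
  case base
  then show ?case by simp
next
  case (Suc n)
  have "1 / (real (Suc n))\<^sup>2 \<le> 1 / real n - 1 / real (Suc n)"
  proof -
    have "1 / (real (Suc n))\<^sup>2 \<le> 1 / (real n * real (Suc n))"
      using Suc.hyps by (intro divide_left_mono) (auto simp: power2_eq_square)
    also have "\<dots> = 1 / real n - 1 / real (Suc n)"
      using Suc.hyps by (simp add: field_simps)
    finally show ?thesis .
  qed
  then show ?case using Suc by simp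
qed

text \<open>Union bound: a pair that is not coprime lies in the set of pairs of multiples of d for d
  its gcd, which is between 2 and n. Each such set has at most (n/d)^2 elements, and together they
  cover at most 3/4 of the square.\<close>

lemma card_coprime_pairs_ge:
  assumes "n \<ge> 2"
  shows "(real n)\<^sup>2 / 4 \<le> real (card (coprime_pairs n))"
proof -
  let ?B = "\<lambda>d. {q \<in> {1..n}. d dvd q} \<times> {q \<in> {1..n}. d dvd q}"
  have "{1..n} \<times> {1..n} \<subseteq> coprime_pairs n \<union> (\<Union>d\<in>{2..n}. ?B d)"
  proof (clarify)
    fix a b assume ab: "a \<in> {1..n}" "b \<in> {1..n}" "(a, b) \<notin> (\<Union>d\<in>{2..n}. ?B d)"
    have "gcd a b \<le> n" "gcd a b > 0" using ab by (auto intro: order_trans[OF gcd_le1_nat])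
    moreover have "gcd a b \<notin> {2..n}" using ab by auto
    ultimately have "gcd a b = 1" unfolding atLeastAtMost_iff by linarith
    then show "(a, b) \<in> coprime_pairs n"
      using ab by (simp add: coprime_pairs_def coprime_iff_gcd_eq_1)
  qed
  then have "card ({1..n} \<times> {1..n}) \<le> card (coprime_pairs n \<union> (\<Union>d\<in>{2..n}. ?B d))"
    by (intro card_mono) auto
  also have "\<dots> \<le> card (coprime_pairs n) + card (\<Union>d\<in>{2..n}. ?B d)"
    by (rule card_Un_le)
  also have "card (\<Union>d\<in>{2..n}. ?B d) \<le> (\<Sum>d=2..n. card (?B d))"
    by (rule card_UN_le) simp
  finally have "n * n \<le> card (coprime_pairs n) + (\<Sum>d=2..n. card (?B d))"
    by simp
  then have "real (n * n) \<le> real (card (coprime_pairs n)) + (\<Sum>d=2..n. real (card (?B d)))"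
    unfolding of_nat_sum[symmetric] of_nat_add[symmetric] by (rule of_nat_mono)
  also have "(\<Sum>d=2..n. real (card (?B d))) \<le> (\<Sum>d=2..n. (real n)\<^sup>2 * (1 / (real d)\<^sup>2))"
  proof (rule sum_mono)
    fix d
    have "real (card (?B d)) = (real (card {q \<in> {1..n}. d dvd q}))\<^sup>2"
      by (simp add: power2_eq_square)
    also have "\<dots> \<le> (real n / real d)\<^sup>2"
      by (intro power_mono card_multiples_le_real) simp
    finally show "real (card (?B d)) \<le> (real n)\<^sup>2 * (1 / (real d)\<^sup>2)"
      by (simp add: power_divide)
  qed
  also have "\<dots> \<le> (real n)\<^sup>2 * (3/4)"
  proof -
    have "(\<Sum>d=2..n. 1 / (real d)\<^sup>2) \<le> 3/4 - 1 / real n"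
      using sum_inverse_squares_le assms by blast
    also have "\<dots> \<le> 3/4" by simp
    finally show ?thesis unfolding sum_distrib_left[symmetric] by (rule mult_left_mono) simp
  qed
  finally show ?thesis by (simp add: power2_eq_square)
qed

text \<open>Cauchy-Schwarz for the representation counts \<open>r m\<close>: their sum is the number
  of coprime pairs, at least n^2/4, while the sum of their squares is at most (n
  \<open>harm n\<close>)^2.\<close>

lemma card_coprime_products_ge:
  assumes "n \<ge> 2"
  shows "(real n)\<^sup>2 / (16 * (harm n)\<^sup>2) \<le> real (card (coprime_products n))"
proof -
  let ?P = "coprime_pairs n" and ?M = "coprime_products n"
  let ?f = "\<lambda>(a, b). a * b :: nat"
  define r where "r m = card {p \<in> ?P. ?f p = m}" for m
  \<comment> \<open>A pair with product m > 0 is determined by its first entry, which divides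
    m.\<close>
  have r_le: "r m \<le> divisor_count m" if "m \<in> ?M" for m
  proof -
    have m: "m > 0" using that coprime_products_subset[of n] by auto
    have "fst ` {p \<in> ?P. ?f p = m} \<subseteq> {d. d dvd m}" by auto
    moreover have "inj_on fst {p \<in> ?P. ?f p = m}"
      using m by (auto simp: inj_on_def)
    ultimately show ?thesis
      unfolding r_def divisor_count_def using m
      by (metis card_image card_mono finite_divisors_nat)
  qed
  have fib: "(\<Sum>p\<in>?P. g (?f p)) = (\<Sum>m\<in>?M. real (r m) * g m)" for g :: "nat \<Rightarrow> real"
    unfolding coprime_products_def r_def
    by (subst sum.image_gen[of ?P _ ?f]) (auto intro!: sum.cong)
  \<comment> \<open>One factor \<open>r m\<close> is turned back into a sum over pairs, the other is
    bounded by divisor counts. Enlarging the range to all pairs then makes the double sum a perfect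
    square.\<close>
  have "(\<Sum>m\<in>?M. (real (r m))\<^sup>2) = (\<Sum>p\<in>?P. real (r (?f p)))"
    using fib[of "\<lambda>m. real (r m)"] by (simp add: power2_eq_square)
  also have "\<dots> \<le> (\<Sum>p\<in>?P. real (divisor_count (fst p)) * real (divisor_count (snd p)))"
  proof (rule sum_mono)
    fix p assume p: "p \<in> ?P"
    then have "r (?f p) \<le> divisor_count (?f p)"
      by (intro r_le) (auto simp: coprime_products_def)
    also have "\<dots> \<le> divisor_count (fst p) * divisor_count (snd p)"
      using p divisor_count_mult_le[of "fst p" "snd p"]
      by (auto simp: coprime_pairs_def split: prod.splits)
    finally show "real (r (?f p)) \<le> real (divisor_count (fst p)) * real (divisor_count (snd p))"
      by (metis of_nat_mono of_nat_mult)
  qed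
  also have "\<dots> \<le> (\<Sum>p\<in>{1..n}\<times>{1..n}. real (divisor_count (fst p)) * real (divisor_count (snd p)))"
    by (rule sum_mono2) (auto simp: coprime_pairs_def)
  also have "\<dots> = (\<Sum>q=1..n. real (divisor_count q))\<^sup>2"
    by (simp add: power2_eq_square sum_product sum.cartesian_product split_def)
  also have "\<dots> \<le> (real n * harm n)\<^sup>2"
    by (intro power_mono sum_divisor_count_le sum_nonneg) auto
  finally have energy: "(\<Sum>m\<in>?M. (real (r m))\<^sup>2) \<le> (real n * harm n)\<^sup>2" .
  have "((real n)\<^sup>2 / 4)\<^sup>2 \<le> (real (card ?P))\<^sup>2"
    using card_coprime_pairs_ge[OF assms] by (intro power_mono) auto
  also have "\<dots> = (\<Sum>m\<in>?M. real (r m))\<^sup>2"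
    using fib[of "\<lambda>_. 1"] by simp
  also have "\<dots> \<le> (\<Sum>m\<in>?M. (real (r m))\<^sup>2) * real (card ?M)"
    by (rule sum_squared_le_sum_of_squares)
  also have "\<dots> \<le> (real n * harm n)\<^sup>2 * real (card ?M)"
    using energy by (rule mult_right_mono) simp
  finally have "(real n)\<^sup>2 * (real n)\<^sup>2 \<le> (real n)\<^sup>2 * (16 * (harm n)\<^sup>2 * real (card ?M))"
    by (simp add: power2_eq_square field_simps)
  then have "(real n)\<^sup>2 \<le> 16 * (harm n)\<^sup>2 * real (card ?M)"
    using assms by (subst (asm) mult_le_cancel_left) auto
  then show ?thesis
    using assms harm_pos[of n, where 'a=real] by (simp add: divide_le_eq mult.commute)
qed

text \<open>With c = \<open>card M\<close>, comparison with 0 + 1 + ... + (c - 1) gives c(c - 1)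
  \<le> 2 \<open>\<Sum>M\<close>. Positivity of the elements gives c \<le> \<open>\<Sum>M\<close>,
  and adding the two yields the factor 3.\<close>

lemma square_card_le_sum:
  fixes M :: "nat set"
  assumes "finite M" "0 \<notin> M"
  shows "(real (card M))\<^sup>2 / 3 \<le> (\<Sum>m\<in>M. real m)"
proof -
  have "card M = (\<Sum>m\<in>M. 1)" by simp
  also have "\<dots> \<le> \<Sum>M" using assms by (intro sum_mono) (auto intro: Suc_leI Nat.gr0I)
  finally have 1: "real (card M) \<le> real (\<Sum>M)" by (rule of_nat_mono)
  have "card M * (card M - 1) div 2 \<le> \<Sum>M"
    using card_sum_le_nat_sum[of M] by (simp add: Sum_Ico_nat)
  \<comment> \<open>Parity makes the division by 2 in the natural numbers exact.\<close>
  moreover have "even (card M * (card M - 1))" by (cases "card M") auto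
  ultimately have "card M * (card M - 1) \<le> 2 * \<Sum>M"
    by (metis dvd_mult_div_cancel mult_le_mono2)
  then have "real (card M * (card M - 1)) \<le> real (2 * \<Sum>M)" by (rule of_nat_mono)
  moreover have "real (card M * (card M - 1)) = real (card M) * (real (card M) - 1)"
    by (cases "card M") (auto simp: algebra_simps)
  ultimately have "real (card M) * (real (card M) - 1) \<le> 2 * real (\<Sum>M)" by (simp only: of_nat_mult of_nat_numeral)
  with 1 show ?thesis by (simp add: power2_eq_square algebra_simps)
qed

subsection \<open>Overlaps of short intervals around fractions\<close>

text \<open>A right-endpoint Riemann sum of a decreasing function is at most the area under it, here
  a triangle of height 2\<delta> and base 2\<delta>L. The proof evaluates the sum and completes the
  square around K = 2\<delta>L.\<close>

lemma sum_triangle_pos_le: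
  fixes \<delta> L :: real
  assumes "L > 0" "\<delta> > 0"
  shows "(\<Sum>h=1..nat \<lfloor>2 * \<delta> * L\<rfloor>. 2 * \<delta> - real h / L) \<le> 2 * \<delta>\<^sup>2 * L"
proof -
  define K where "K = nat \<lfloor>2 * \<delta> * L\<rfloor>"
  have "(\<Sum>h=1..K. 2 * \<delta> - real h / L) = 2 * \<delta> * real K - (\<Sum>h=1..K. real h) / L"
    by (simp add: sum_subtractf sum_divide_distrib)
  also have "(\<Sum>h=1..K. real h) = real K * (real K + 1) / 2"
    by (induction K) (auto simp: field_simps)
  also have "2 * \<delta> * real K - real K * (real K + 1) / 2 / L
      = 2 * \<delta>\<^sup>2 * L - (real K - 2 * \<delta> * L)\<^sup>2 / (2 * L) - real K / (2 * L)"
    using assms by (simp add: field_simps power2_eq_square)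
  also have "\<dots> \<le> 2 * \<delta>\<^sup>2 * L - 0 - 0"
    using assms by (intro diff_mono order_refl) auto
  finally show ?thesis by (simp add: K_def)
qed

text \<open>The summand vanishes for |h| > 2\<delta>L. The term h = 0 gives 2\<delta>, and the
  positive and the negative h give at most one triangle area each.\<close>

lemma sum_triangle_le:
  fixes \<delta> L :: real
  assumes "L > 0" "\<delta> > 0" "finite A"
  shows "(\<Sum>h\<in>A. max 0 (2 * \<delta> - \<bar>of_int h\<bar> / L)) \<le> 2 * \<delta> + 4 * \<delta>\<^sup>2 * L"
proof -
  define K where "K = nat \<lfloor>2 * \<delta> * L\<rfloor>"
  define \<phi> where "\<phi> h = max 0 (2 * \<delta> - \<bar>of_int h\<bar> / L)" for h :: int
  have zero: "\<phi> h = 0" if "h \<notin> {- int K..int K}" for h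
  proof -
    have "int K < \<bar>h\<bar>" using that by auto
    then have "\<lfloor>2 * \<delta> * L\<rfloor> < \<bar>h\<bar>" unfolding K_def by linarith
    then have "2 * \<delta> * L < \<bar>of_int h\<bar>" by linarith
    then show ?thesis using assms by (simp add: \<phi>_def field_simps)
  qed
  have pos: "\<phi> (int h) = 2 * \<delta> - real h / L" if "h \<in> {1..K}" for h
  proof -
    have "real h \<le> 2 * \<delta> * L" using that assms by (auto simp: K_def) linarith
    then show ?thesis using assms by (simp add: \<phi>_def field_simps)
  qed
  have "sum \<phi> A = sum \<phi> (A \<inter> {- int K..int K})"
    using assms zero by (intro sum.mono_neutral_right) auto
  also have "\<dots> \<le> sum \<phi> {- int K..int K}"
    by (intro sum_mono2) (auto simp: \<phi>_def)
  also have "{- int K..int K} = insert 0 (int ` {1..K} \<union> (\<lambda>h. - int h) ` {1..K})" (is "_ = insert 0 (?P \<union> ?Q)")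
  proof safe
    fix h assume h: "h \<in> {- int K..int K}" "h \<noteq> 0" "h \<notin> (\<lambda>h. - int h) ` {1..K}"
    have "h > 0"
    proof (rule ccontr)
      assume "\<not> h > 0"
      then have "h = - int (nat (- h))" "nat (- h) \<in> {1..K}" using h by auto
      then show False using h(3) by blast
    qed
    then have "h = int (nat h)" "nat h \<in> {1..K}" using h by auto
    then show "h \<in> int ` {1..K}" by blast
  qed auto
  also have "sum \<phi> (insert 0 (?P \<union> ?Q)) = \<phi> 0 + (sum \<phi> ?P + sum \<phi> ?Q)"
    by (subst sum.insert, (auto)[2], subst sum.union_disjoint) auto
  also have "sum \<phi> ?P = (\<Sum>h=1..K. \<phi> (int h))"
    by (subst sum.reindex) (auto simp: inj_on_def)
  also have "sum \<phi> ?Q = (\<Sum>h=1..K. \<phi> (int h))"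
    by (subst sum.reindex) (auto simp: inj_on_def \<phi>_def)
  also have "(\<Sum>h=1..K. \<phi> (int h)) = (\<Sum>h=1..K. 2 * \<delta> - real h / L)"
    using pos by (intro sum.cong) auto
  also have "\<phi> 0 + ((\<Sum>h=1..K. 2 * \<delta> - real h / L) + (\<Sum>h=1..K. 2 * \<delta> - real h / L)) \<le> 2 * \<delta> + 4 * \<delta>\<^sup>2 * L"
    using sum_triangle_pos_le[of L \<delta>] assms by (simp add: K_def \<phi>_def mult_ac)
  finally show ?thesis by (simp add: \<phi>_def)
qed

text \<open>As v is invertible modulo u, the equation fixes a modulo u, and a then fixes b. So
  \<open>a div u\<close>, which takes at most g values, determines the solution.\<close>

lemma card_linear_fibre_le:
  fixes g u v :: nat and h :: int
  assumes "u > 0" "v > 0" "coprime u v"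
  shows "card {(a, b) \<in> {..<g * u} \<times> {..<g * v}. int a * int v - int b * int u = h} \<le> g"
    (is "card ?F \<le> g")
proof -
  have "inj_on (\<lambda>(a, b). a div u) ?F"
  proof (rule inj_onI)
    fix s t assume st: "s \<in> ?F" "t \<in> ?F" "(\<lambda>(a, b). a div u) s = (\<lambda>(a, b). a div u) t"
    obtain a b a' b' where [simp]: "s = (a, b)" "t = (a', b')" by fastforce
    from st have eq: "a div u = a' div u"
      and h: "int a * int v - int b * int u = int a' * int v - int b' * int u" by auto
    have "(int a - int a') * int v = (int b - int b') * int u"
      using h by (simp add: algebra_simps)
    then have "int u dvd (int a - int a') * int v" by simp
    then have "int u dvd int a - int a'"
      using assms by (simp add: coprime_dvd_mult_left_iff)
    then have "int a mod int u = int a' mod int u" by (simp add: mod_eq_dvd_iff)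
    then have "a mod u = a' mod u" by (simp only: of_nat_mod[symmetric] of_nat_eq_iff)
    with eq have "u * (a div u) + a mod u = u * (a' div u) + a' mod u" by simp
    then have a: "a = a'" by (simp only: mult_div_mod_eq)
    with h have "int b * int u = int b' * int u" by simp
    with a assms show "s = t" by simp
  qed
  moreover have "(\<lambda>(a, b). a div u) ` ?F \<subseteq> {..<g}"
    using assms by (auto simp: less_mult_imp_div_less)
  ultimately have "card ?F \<le> card {..<g}"
    by (rule card_inj_on_le) simp
  then show ?thesis by simp
qed

text \<open>With m = gu and k = gv, the difference of the fractions is h/L, where h = av - bu and L
  = guv is the least common multiple. Each h occurs at most g times, so g times the triangle bound
  applies, and gL = mk gives the main term.\<close>

lemma sum_overlap_le:
  fixes \<delta> :: real and m k :: nat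
  assumes "m > 0" "k > 0" "\<delta> > 0"
  shows "(\<Sum>a<m. \<Sum>b<k. max 0 (2 * \<delta> - \<bar>real a / real m - real b / real k\<bar>))
           \<le> (2 * \<delta> * real m) * (2 * \<delta> * real k) + 2 * \<delta> * real (gcd m k)"
proof -
  define g where "g = gcd m k"
  have "gcd m k \<noteq> 0" using assms by simp
  from gcd_coprime_exists[OF this] obtain u v
    where "m = u * gcd m k" "k = v * gcd m k" and cop: "coprime u v" by blast
  then have uv: "m = g * u" "k = g * v"
    unfolding g_def[symmetric] mult.commute[of g] by simp_all
  then have pos: "g > 0" "u > 0" "v > 0" using assms by (auto intro: Nat.gr0I)
  define L where "L = real g * real u * real v"
  have L: "L > 0" using pos by (simp add: L_def)
  define T where "T = {..<m} \<times> {..<k}"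
  define \<theta> where "\<theta> = (\<lambda>(a, b). int a * int v - int b * int u)"
  define \<phi> where "\<phi> h = max 0 (2 * \<delta> - \<bar>of_int h\<bar> / L)" for h :: int
  have "(\<Sum>a<m. \<Sum>b<k. max 0 (2 * \<delta> - \<bar>real a / real m - real b / real k\<bar>)) = (\<Sum>t\<in>T. \<phi> (\<theta> t))"
  proof -
    have "\<bar>real a / real m - real b / real k\<bar> = \<bar>of_int (\<theta> (a, b))\<bar> / L" for a b
    proof -
      have "real a / real m - real b / real k = of_int (\<theta> (a, b)) / L"
        using pos by (simp add: \<theta>_def uv L_def field_simps)
      then show ?thesis using L by simp
    qed
    then show ?thesis
      unfolding T_def \<phi>_def by (subst sum.cartesian_product) (simp add: split_def)
  qed
  also have "\<dots> = (\<Sum>h\<in>\<theta> ` T. \<Sum>t\<in>{t \<in> T. \<theta> t = h}. \<phi> (\<theta> t))"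
    by (rule sum.image_gen) (simp add: T_def)
  also have "\<dots> = (\<Sum>h\<in>\<theta> ` T. real (card {t \<in> T. \<theta> t = h}) * \<phi> h)"
    by (intro sum.cong) auto
  also have "\<dots> \<le> (\<Sum>h\<in>\<theta> ` T. real g * \<phi> h)"
  proof (intro sum_mono mult_right_mono)
    fix h
    have "{t \<in> T. \<theta> t = h} = {(a, b) \<in> {..<g * u} \<times> {..<g * v}. int a * int v - int b * int u = h}"
      by (auto simp: T_def \<theta>_def uv)
    then show "real (card {t \<in> T. \<theta> t = h}) \<le> real g"
      using card_linear_fibre_le[of u v g h] pos cop by simp
  qed (simp add: \<phi>_def)
  also have "\<dots> \<le> real g * (2 * \<delta> + 4 * \<delta>\<^sup>2 * L)"
    unfolding sum_distrib_left[symmetric] \<phi>_def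
    using L assms by (intro mult_left_mono sum_triangle_le) (auto simp: T_def)
  also have "\<dots> = (2 * \<delta> * real m) * (2 * \<delta> * real k) + 2 * \<delta> * real (gcd m k)"
    unfolding g_def[symmetric] by (simp add: L_def uv algebra_simps power2_eq_square)
  finally show ?thesis .
qed

section \<open>Measure of overlaps and the second-moment bound\<close>

lemma interval_overlap:
  fixes x y \<delta> :: real
  shows "{x - \<delta>..x + \<delta>} \<inter> {y - \<delta>..y + \<delta>} = {max x y - \<delta>..min x y + \<delta>}"
  by auto

lemma measure_interval_overlap:
  fixes x y \<delta> :: real
  assumes "\<delta> > 0"
  shows "measure lborel ({x - \<delta>..x + \<delta>} \<inter> {y - \<delta>..y + \<delta>}) = max 0 (2 * \<delta> - \<bar>x - y\<bar>)"
proof -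
  show ?thesis
  proof (cases "max x y - \<delta> \<le> min x y + \<delta>")
    case True
    then show ?thesis unfolding interval_overlap by (subst measure_lborel_Icc) auto
  next
    case False
    then show ?thesis unfolding interval_overlap by (auto simp: max_def min_def split: if_splits)
  qed
qed

text \<open>Chebyshev's inequality for the number of intervals covering \<alpha>. The intervals are
  not reduced modulo 1, so the count is compared with its mean \<mu> on
  {- \<delta>..1 + \<delta>}; the excess length of this interval costs the term 2 * \<delta>.\<close>

lemma measure_uncovered_le:
  fixes x :: "'a \<Rightarrow> real" and \<delta> V :: real
  assumes T: "finite T" "T \<noteq> {}" and \<delta>: "\<delta> > 0"
    and x: "\<And>t. t \<in> T \<Longrightarrow> 0 \<le> x t \<and> x t \<le> 1"
    and overlap: "(\<Sum>s\<in>T. \<Sum>t\<in>T. max 0 (2 * \<delta> - \<bar>x s - x t\<bar>)) \<le> (2 * \<delta> * real (card T))\<^sup>2 + V"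
  shows "measure lborel {\<alpha> \<in> {0..<1}. \<forall>t\<in>T. \<bar>\<alpha> - x t\<bar> > \<delta>} \<le> V / (2 * \<delta> * real (card T))\<^sup>2 + 2 * \<delta>"
proof -
  define \<mu> where "\<mu> = 2 * \<delta> * real (card T)"
  have \<mu>: "\<mu> > 0" using T \<delta> by (simp add: \<mu>_def card_gt_0_iff)
  define I where "I t = {x t - \<delta>..x t + \<delta>}" for t
  define J where "J = {- \<delta>..1 + \<delta>}"
  define B where "B = {\<alpha> \<in> {0..<1}. \<forall>t\<in>T. \<bar>\<alpha> - x t\<bar> > \<delta>}"
  have B_eq: "B = {0..<1} - (\<Union>t\<in>T. I t)"
    by (force simp: B_def I_def abs_le_iff not_less)
  have B_sets: "B \<in> sets lborel" unfolding B_eq using T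
    by (intro sets.Diff sets.finite_UN) (auto simp: I_def)
  have B_fin: "emeasure lborel B < \<infinity>"
  proof -
    have "emeasure lborel B \<le> emeasure lborel {0..<1::real}"
      by (intro emeasure_mono) (auto simp: B_eq)
    then show ?thesis by (simp add: le_less_trans)
  qed
  \<comment> \<open>On \<open>J\<close> this is the square of (covering count - \<mu>), and off
    \<open>J\<close> it is 0. The expanded form is a combination of indicators, so its integral can
    be read off.\<close>
  define h where "h \<alpha> = (\<Sum>s\<in>T. \<Sum>t\<in>T. indicator (I s \<inter> I t) \<alpha>) - 2 * \<mu> * (\<Sum>t\<in>T. indicator (I t) \<alpha>)
      + \<mu>\<^sup>2 * (indicator J \<alpha> :: real)" for \<alpha>
  have hb: "has_bochner_integral lborel (indicator {a..b} :: real \<Rightarrow> real) (measure lborel {a..b})" for a b :: real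
    by (rule has_bochner_integral_real_indicator) (auto simp: emeasure_lborel_Icc_eq)
  have hb_I: "has_bochner_integral lborel (indicator (I t) :: real \<Rightarrow> real) (measure lborel (I t))" for t
    unfolding I_def by (rule hb)
  have hb_II: "has_bochner_integral lborel (indicator (I s \<inter> I t) :: real \<Rightarrow> real)
      (measure lborel (I s \<inter> I t))" for s t
    unfolding I_def interval_overlap by (rule hb)
  have hb_J: "has_bochner_integral lborel (indicator J :: real \<Rightarrow> real) (measure lborel J)"
    unfolding J_def by (rule hb)
  have hb_h: "has_bochner_integral lborel h ((\<Sum>s\<in>T. \<Sum>t\<in>T. measure lborel (I s \<inter> I t))
      - 2 * \<mu> * (\<Sum>t\<in>T. measure lborel (I t)) + \<mu>\<^sup>2 * measure lborel J)"
    unfolding h_def[abs_def]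
    by (intro has_bochner_integral_add has_bochner_integral_diff has_bochner_integral_sum
        has_bochner_integral_mult_right hb_I hb_II hb_J)
  \<comment> \<open>On \<open>B\<close> the covering count is 0, so \<open>h\<close> equals the
    square of \<mu> there. Off \<open>J\<close> all terms vanish, because the centres lie in
    [0,1].\<close>
  have "\<mu>\<^sup>2 * indicator B \<alpha> \<le> h \<alpha>" for \<alpha>
  proof (cases "\<alpha> \<in> J")
    case True
    have "(\<Sum>s\<in>T. \<Sum>t\<in>T. indicator (I s \<inter> I t) \<alpha>) = (\<Sum>t\<in>T. indicator (I t) \<alpha> :: real)\<^sup>2"
      by (simp add: power2_eq_square sum_product indicator_inter_arith)
    then have h_sq: "h \<alpha> = ((\<Sum>t\<in>T. indicator (I t) \<alpha>) - \<mu>)\<^sup>2"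
      using True by (simp add: h_def power2_eq_square algebra_simps)
    show ?thesis
    proof (cases "\<alpha> \<in> B")
      case True
      then have "(\<Sum>t\<in>T. indicator (I t) \<alpha>) = (0::real)"
        by (intro sum.neutral) (auto simp: B_eq indicator_def)
      then show ?thesis using True h_sq by simp
    qed (simp add: h_sq)
  next
    case False
    have "\<alpha> \<notin> I t" if "t \<in> T" for t using x[OF that] False by (auto simp: I_def J_def)
    then have "h \<alpha> = 0" using False by (simp add: h_def)
    moreover have "\<alpha> \<notin> B" using False \<delta> by (auto simp: B_def J_def)
    ultimately show ?thesis by simp
  qed
  then have "(\<integral>\<alpha>. \<mu>\<^sup>2 * indicator B \<alpha> \<partial>lborel) \<le> integral\<^sup>L lborel h"
    using integrable.intros[OF hb_h] B_sets B_fin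
    by (intro integral_mono integrable_mult_right integrable_real_indicator) simp_all
  moreover have "integral\<^sup>L lborel h = (\<Sum>s\<in>T. \<Sum>t\<in>T. measure lborel (I s \<inter> I t))
      - 2 * \<mu> * (\<Sum>t\<in>T. measure lborel (I t)) + \<mu>\<^sup>2 * measure lborel J"
    by (rule has_bochner_integral_integral_eq[OF hb_h])
  moreover have "(\<Sum>s\<in>T. \<Sum>t\<in>T. measure lborel (I s \<inter> I t)) \<le> \<mu>\<^sup>2 + V"
    using overlap unfolding I_def measure_interval_overlap[OF \<delta>] \<mu>_def .
  moreover have "(\<Sum>t\<in>T. measure lborel (I t)) = \<mu>"
    using \<delta> by (simp add: I_def \<mu>_def)
  moreover have "measure lborel J = 1 + 2 * \<delta>"
    using \<delta> by (simp add: J_def)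
  \<comment> \<open>The integral is at most (\<mu>^2 + V) - 2\<mu>^2 + \<mu>^2 (1 +
    2\<delta>).\<close>
  ultimately have "\<mu>\<^sup>2 * measure lborel B \<le> V + 2 * \<delta> * \<mu>\<^sup>2"
    by (simp add: power2_eq_square algebra_simps)
  then have "measure lborel B \<le> V / \<mu>\<^sup>2 + 2 * \<delta>"
    using \<mu> by (simp add: field_simps)
  then show ?thesis by (simp add: B_def \<mu>_def)
qed

subsection \<open>The exceptional set\<close>

text \<open>Multiply a Bezout identity ua + vb = 1 by c and divide by ab.\<close>

lemma fraction_split_coprime:
  fixes a b :: nat and c :: int
  assumes "a > 0" "b > 0" "coprime a b"
  obtains x y :: int where "real_of_int c / real (a * b) = of_int x / real a + of_int y / real b"
proof -
  obtain u v where uv: "u * int a + v * int b = 1"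
    using bezout_int[of "int a" "int b"] assms(3) by auto
  have "real_of_int c = real_of_int (c * (u * int a + v * int b))" by (simp only: uv mult_1_right)
  then have "real_of_int c / real (a * b) = of_int (c * v) / real a + of_int (c * u) / real b"
    using assms by (simp add: field_simps)
  then show thesis by (rule that)
qed

text \<open>Since q \<le> n^2 and C \<ge> 1, the permitted error is at least n^(\<epsilon> - 4) for
  every admissible q. The separate exponent e \<le> \<epsilon> lets the measure estimate work with a
  small exponent.\<close>

lemma two_fraction_approx_if_near_coprime_product:
  assumes m: "m \<in> coprime_products n" and near: "\<bar>\<alpha> - of_int c / real m\<bar> \<le> real n powr (e - 4)"
    and "n > 0" "e \<le> \<epsilon>" "C \<ge> 1"
  shows "two_fraction_approx C \<epsilon> (int n) \<alpha>"
  unfolding two_fraction_approx_def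
proof (intro allI impI)
  fix a q :: int
  assume q: "1 \<le> q \<and> q \<le> (int n)\<^sup>2 \<and> coprime a q \<and>
    \<bar>\<alpha> - of_int a / of_int q\<bar> \<le> 1 / (of_int q * (of_int (int n))\<^sup>2)"
  obtain s t where st: "m = s * t" "s \<in> {1..n}" "t \<in> {1..n}" "coprime s t"
    using m by (auto simp: coprime_products_def coprime_pairs_def)
  then obtain x y :: int where xy: "real_of_int c / real m = of_int x / real s + of_int y / real t"
    using fraction_split_coprime[of s t c] by auto
  have "real_of_int q \<le> (real n)\<^sup>2"
    using q by (metis of_int_le_iff of_int_of_nat_eq of_int_power)
  then have "of_int q * real n powr (2 - \<epsilon>) \<le> real n powr 2 * real n powr (2 - \<epsilon>)"
    using assms by (intro mult_right_mono) simp_all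
  also have "\<dots> = real n powr (4 - \<epsilon>)"
    by (simp only: powr_add[symmetric]) simp
  finally have "1 / real n powr (4 - \<epsilon>) \<le> 1 / (of_int q * real n powr (2 - \<epsilon>))"
    using assms q by (intro divide_left_mono) auto
  also have "\<dots> \<le> C / (of_int q * real n powr (2 - \<epsilon>))"
    using assms q by (intro divide_right_mono) auto
  finally have "real n powr (\<epsilon> - 4) \<le> C / (of_int q * real n powr (2 - \<epsilon>))"
    by (simp add: powr_minus_divide[symmetric])
  moreover have "real n powr (e - 4) \<le> real n powr (\<epsilon> - 4)"
    using assms by (intro powr_mono) auto
  ultimately have "\<bar>\<alpha> - of_int x / of_int (int s) - of_int y / of_int (int t)\<bar>
      \<le> C / (of_int q * of_int (int n) powr (2 - \<epsilon>))"
    using near xy by (simp add: diff_diff_eq)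
  then show "\<exists>a\<^sub>1 a\<^sub>2 q\<^sub>1 q\<^sub>2 :: int. 1 \<le> q\<^sub>1 \<and> q\<^sub>1 \<le> int n \<and> 1 \<le> q\<^sub>2 \<and> q\<^sub>2 \<le> int n \<and>
           \<bar>\<alpha> - of_int a\<^sub>1 / of_int q\<^sub>1 - of_int a\<^sub>2 / of_int q\<^sub>2\<bar>
             \<le> C / (of_int q * of_int (int n) powr (2 - \<epsilon>))"
    using st by (intro exI[of _ x] exI[of _ y] exI[of _ "int s"] exI[of _ "int t"]) auto
qed

text \<open>All quantifiers range over the countable type \<open>int\<close>.\<close>

lemma measurable_two_fraction_approx [measurable]:
  "Measurable.pred borel (two_fraction_approx C \<epsilon> N)"
  unfolding two_fraction_approx_def[abs_def] by measurable

lemma measure_far_from_coprime_products_le: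
  fixes \<delta> :: real
  assumes n: "n \<ge> 2" and \<delta>: "\<delta> > 0"
  shows "measure lborel {\<alpha> \<in> {0..<1}. \<forall>m\<in>coprime_products n. \<forall>b<m. \<bar>\<alpha> - real b / real m\<bar> > \<delta>}
    \<le> 294912 * (1 + 2 * ln (real n)) ^ 9 / (\<delta> * real n ^ 4) + 2 * \<delta>"
proof -
  let ?M = "coprime_products n"
  \<comment> \<open>Indexing by pairs counts equal fractions with multiplicity, so that
    \<open>card T\<close> is exactly the sum of the elements of \<open>?M\<close>.\<close>
  define T where "T = (SIGMA m:?M. {..<m})"
  define x where "x = (\<lambda>(m, b). real b / real m)"
  define S where "S = (\<Sum>m\<in>?M. real m)"
  define l where "l = 1 + 2 * ln (real n)"
  define V where "V = 2 * \<delta> * ((real (n\<^sup>2))\<^sup>2 * harm (n\<^sup>2))"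
  have M_pos: "m > 0" if "m \<in> ?M" for m using that coprime_products_subset[of n] by auto
  have card_T: "real (card T) = S" by (simp add: T_def S_def)
  have "ln (real n) \<ge> 0" "ln (real (n\<^sup>2)) = 2 * ln (real n)"
    using n by (simp_all add: ln_realpow)
  moreover have "harm n \<le> 1 + ln (real n)" "harm (n\<^sup>2) \<le> 1 + ln (real (n\<^sup>2))"
    using n by (intro harm_le_ln; simp)+
  ultimately have l: "harm n \<le> l" "harm (n\<^sup>2) \<le> l" "l \<ge> 1"
    unfolding l_def by linarith+
  \<comment> \<open>The constant is 768 = 3 * 16^2: 16 from the lower bound for the cardinality, 3
    from \<open>square_card_le_sum\<close>.\<close>
  have S_ge: "real n ^ 4 / (768 * l ^ 4) \<le> S"
  proof -
    have "(real n)\<^sup>2 / (16 * l\<^sup>2) \<le> (real n)\<^sup>2 / (16 * (harm n)\<^sup>2)"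
    proof (intro divide_left_mono mult_left_mono power_mono mult_pos_pos zero_less_power)
      show "harm n > (0::real)" using n by (intro harm_pos) simp
    qed (use l in \<open>auto intro: harm_nonneg\<close>)
    also have "\<dots> \<le> real (card ?M)" by (rule card_coprime_products_ge[OF n])
    finally have "((real n)\<^sup>2 / (16 * l\<^sup>2))\<^sup>2 / 3 \<le> (real (card ?M))\<^sup>2 / 3"
      by (intro divide_right_mono power_mono) auto
    also have "\<dots> \<le> S"
      unfolding S_def using M_pos by (intro square_card_le_sum) auto
    finally show ?thesis by (simp add: power_divide power_mult_distrib)
  qed
  have S_pos: "S > 0"
    using n l by (intro less_le_trans[OF _ S_ge]) auto
  have "card T > 0" using S_pos unfolding card_T[symmetric] by simp
  then have T: "finite T" "T \<noteq> {}" by (simp_all add: card_gt_0_iff)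
  have sum_T: "(\<Sum>t\<in>T. F (x t)) = (\<Sum>m\<in>?M. \<Sum>a<m. F (real a / real m))" for F :: "real \<Rightarrow> real"
    unfolding T_def x_def by (subst sum.Sigma) (auto simp: split_def)
  have "(\<Sum>s\<in>T. \<Sum>t\<in>T. max 0 (2 * \<delta> - \<bar>x s - x t\<bar>))
      = (\<Sum>s\<in>T. \<Sum>k\<in>?M. \<Sum>b<k. max 0 (2 * \<delta> - \<bar>x s - real b / real k\<bar>))"
    by (intro sum.cong refl sum_T)
  also have "\<dots> = (\<Sum>m\<in>?M. \<Sum>a<m. \<Sum>k\<in>?M. \<Sum>b<k. max 0 (2 * \<delta> - \<bar>real a / real m - real b / real k\<bar>))"
    by (rule sum_T)
  also have "\<dots> = (\<Sum>m\<in>?M. \<Sum>k\<in>?M. \<Sum>a<m. \<Sum>b<k. max 0 (2 * \<delta> - \<bar>real a / real m - real b / real k\<bar>))"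
    by (intro sum.cong refl sum.swap)
  also have "\<dots> \<le> (\<Sum>m\<in>?M. \<Sum>k\<in>?M. (2 * \<delta> * real m) * (2 * \<delta> * real k) + 2 * \<delta> * real (gcd m k))"
    using \<delta> M_pos by (intro sum_mono sum_overlap_le) auto
  also have "\<dots> = (2 * \<delta> * S)\<^sup>2 + 2 * \<delta> * (\<Sum>m\<in>?M. \<Sum>k\<in>?M. real (gcd m k))"
    by (simp only: S_def sum.distrib sum_distrib_left[symmetric] sum_distrib_right[symmetric] power2_eq_square)
  also have "(\<Sum>m\<in>?M. \<Sum>k\<in>?M. real (gcd m k)) \<le> (\<Sum>m=1..n\<^sup>2. \<Sum>k=1..n\<^sup>2. real (gcd m k))"
  proof -
    have "(\<Sum>m\<in>?M. \<Sum>k\<in>?M. real (gcd m k)) \<le> (\<Sum>m\<in>?M. \<Sum>k=1..n\<^sup>2. real (gcd m k))"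
      using coprime_products_subset by (intro sum_mono sum_mono2) auto
    also have "\<dots> \<le> (\<Sum>m=1..n\<^sup>2. \<Sum>k=1..n\<^sup>2. real (gcd m k))"
      using coprime_products_subset by (intro sum_mono2 sum_nonneg) auto
    finally show ?thesis .
  qed
  also have "\<dots> \<le> (real (n\<^sup>2))\<^sup>2 * harm (n\<^sup>2)" by (rule sum_sum_gcd_le)
  finally have overlap: "(\<Sum>s\<in>T. \<Sum>t\<in>T. max 0 (2 * \<delta> - \<bar>x s - x t\<bar>)) \<le> (2 * \<delta> * real (card T))\<^sup>2 + V"
    using \<delta> by (simp add: card_T V_def)
  have far_iff: "(\<forall>t\<in>T. \<bar>\<alpha> - x t\<bar> > \<delta>) \<longleftrightarrow> (\<forall>m\<in>?M. \<forall>b<m. \<bar>\<alpha> - real b / real m\<bar> > \<delta>)" for \<alpha>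
    by (auto simp: T_def x_def)
  have "measure lborel {\<alpha> \<in> {0..<1}. \<forall>t\<in>T. \<bar>\<alpha> - x t\<bar> > \<delta>} \<le> V / (2 * \<delta> * real (card T))\<^sup>2 + 2 * \<delta>"
    using T \<delta> overlap by (intro measure_uncovered_le) (auto simp: T_def x_def)
  also have "V / (2 * \<delta> * real (card T))\<^sup>2 = real n ^ 4 * harm (n\<^sup>2) / (2 * \<delta> * S\<^sup>2)"
    using \<delta> S_pos by (simp add: V_def card_T power2_eq_square power4_eq_xxxx field_simps)
  also have "\<dots> \<le> real n ^ 4 * l / (2 * \<delta> * (real n ^ 4 / (768 * l ^ 4))\<^sup>2)"
    using \<delta> S_pos S_ge l n by (intro frac_le mult_left_mono power_mono) auto
  \<comment> \<open>Here 294912 = 768^2 / 2, and the ninth power is one \<open>l\<close> from the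
    harmonic number times the eighth power from the squared bound for \<open>S\<close>.\<close>
  also have "\<dots> = 294912 * l ^ 9 / (\<delta> * real n ^ 4)"
    using \<delta> l n by (simp add: field_simps eval_nat_numeral)
  finally show ?thesis
    unfolding far_iff l_def by simp
qed

text \<open>After multiplication by sqrt(ln n) both summands tend to 0, as powers of n beat powers
  of logarithms. A convergent sequence is bounded, which gives one constant for all n.\<close>

lemma log_power_decay:
  fixes e :: real
  assumes "0 < e" "e \<le> 1"
  obtains C where "C \<ge> 1" "\<And>n::nat. n \<ge> 2 \<Longrightarrow>
    294912 * (1 + 2 * ln (real n)) ^ 9 / real n powr e + 2 * real n powr (e - 4) \<le> C / sqrt (ln (real n))"
proof -
  define f where "f n = (294912 * (1 + 2 * ln (real n)) ^ 9 / real n powr e + 2 * real n powr (e - 4)) * sqrt (ln (real n))" for n :: nat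
  have "(\<lambda>n::nat. 294912 * (1 + 2 * ln (real n)) ^ 9 / real n powr e * sqrt (ln (real n))) \<longlonglongrightarrow> 0"
    using assms by real_asymp
  moreover have "(\<lambda>n::nat. 2 * real n powr (e - 4) * sqrt (ln (real n))) \<longlonglongrightarrow> 0"
    using assms by real_asymp
  ultimately have "f \<longlonglongrightarrow> 0 + 0"
    unfolding f_def[abs_def] distrib_right by (rule tendsto_add)
  then have "Bseq f" by (rule convergent_imp_Bseq[OF convergentI])
  then obtain K where K: "\<And>n. \<bar>f n\<bar> \<le> K" by (auto simp: Bseq_def)
  show thesis
  proof (rule that[of "max 1 K"])
    fix n :: nat assume "n \<ge> 2"
    then have "sqrt (ln (real n)) > 0" by simp
    moreover have "f n \<le> max 1 K" using K[of n] by linarith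
    ultimately show "294912 * (1 + 2 * ln (real n)) ^ 9 / real n powr e + 2 * real n powr (e - 4)
        \<le> max 1 K / sqrt (ln (real n))"
      by (simp add: f_def pos_le_divide_eq)
  qed simp
qed

theorem theorem4:
  fixes \<epsilon> :: real
  assumes "\<epsilon> > 0"
  shows "\<exists>C > 0. \<forall>N :: int. N \<ge> 2 \<longrightarrow>
    {\<alpha> \<in> {0..<1}. \<not> two_fraction_approx C \<epsilon> N \<alpha>} \<in> sets lebesgue \<and>
    emeasure lebesgue {\<alpha> \<in> {0..<1}. \<not> two_fraction_approx C \<epsilon> N \<alpha>}
      \<le> ennreal (C / sqrt (ln (of_int N)))"
proof -
  \<comment> \<open>Capping the exponent keeps the radius n^(e - 4) small even when \<epsilon> is
    large.\<close>
  define e where "e = min \<epsilon> 1"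
  have e: "0 < e" "e \<le> 1" "e \<le> \<epsilon>" using assms by (auto simp: e_def)
  obtain C where C: "C \<ge> 1" "\<And>n::nat. n \<ge> 2 \<Longrightarrow>
      294912 * (1 + 2 * ln (real n)) ^ 9 / real n powr e + 2 * real n powr (e - 4) \<le> C / sqrt (ln (real n))"
    using log_power_decay[OF e(1,2)] by blast
  show ?thesis
  proof (intro exI[of _ C] conjI allI impI)
    show "C > 0" using C(1) by simp
    fix N :: int assume "N \<ge> 2"
    define n where "n = nat N"
    have n: "n \<ge> 2" "N = int n" using \<open>N \<ge> 2\<close> by (auto simp: n_def)
    define \<delta> where "\<delta> = real n powr (e - 4)"
    have \<delta>: "\<delta> > 0" using n by (simp add: \<delta>_def)
    let ?E = "{\<alpha> \<in> {0..<1}. \<not> two_fraction_approx C \<epsilon> N \<alpha>}"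
    define F where "F = {\<alpha> \<in> {0..<1}. \<forall>m\<in>coprime_products n. \<forall>b<m. \<bar>\<alpha> - real b / real m\<bar> > \<delta>}"
    have E_sets: "?E \<in> sets borel" by measurable
    then show "?E \<in> sets lebesgue" by (simp add: sets_completionI_sets)
    have F_sets: "F \<in> sets borel"
      unfolding F_def by measurable
    have "?E \<subseteq> F"
    proof
      fix \<alpha> assume \<alpha>: "\<alpha> \<in> ?E"
      have "\<not> \<bar>\<alpha> - real b / real m\<bar> \<le> \<delta>" if "m \<in> coprime_products n" for m b
        using two_fraction_approx_if_near_coprime_product[OF that, of \<alpha> "int b" e \<epsilon> C] \<alpha> n e C(1)
        by (auto simp: \<delta>_def)
      with \<alpha> show "\<alpha> \<in> F" by (auto simp: F_def not_le)
    qed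
    have F_fin: "emeasure lborel F \<noteq> \<infinity>"
    proof -
      have "emeasure lborel F \<le> emeasure lborel {0..<1::real}"
        by (intro emeasure_mono) (auto simp: F_def)
      then show ?thesis by (auto simp: top_unique)
    qed
    have "measure lborel F \<le> 294912 * (1 + 2 * ln (real n)) ^ 9 / (\<delta> * real n ^ 4) + 2 * \<delta>"
      unfolding F_def using n \<delta> by (intro measure_far_from_coprime_products_le)
    \<comment> \<open>This product is n^e, the power that absorbs all logarithms.\<close>
    also have "\<delta> * real n ^ 4 = real n powr (e - 4) * real n powr 4"
      using n by (simp add: \<delta>_def)
    also have "\<dots> = real n powr e" by (simp only: powr_add[symmetric]) simp
    also have "294912 * (1 + 2 * ln (real n)) ^ 9 / real n powr e + 2 * \<delta> \<le> C / sqrt (ln (real n))"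
      unfolding \<delta>_def by (rule C(2)[OF n(1)])
    finally have F_le: "measure lborel F \<le> C / sqrt (ln (real n))" .
    have "emeasure lebesgue ?E = emeasure lborel ?E"
      using E_sets by simp
    also have "\<dots> \<le> emeasure lborel F"
      using \<open>?E \<subseteq> F\<close> F_sets by (intro emeasure_mono) auto
    also have "\<dots> = ennreal (measure lborel F)"
      using F_fin by (intro emeasure_eq_ennreal_measure) simp
    also have "\<dots> \<le> ennreal (C / sqrt (ln (of_int N)))"
      using F_le n by (intro ennreal_leI) simp
    finally show "emeasure lebesgue ?E \<le> ennreal (C / sqrt (ln (of_int N)))" .
  qed
qed

end
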